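(* Let $\gamma>0$ and $\ell_1^+(\gamma)=1+(\gamma+\sqrt{\gamma^2+8\gamma})/2$. Then $\ell_1^+(\gamma)>\ell_+(\gamma)$. For every $\ell>\ell_+(\gamma)$, with $\lambda=\lambda(\ell;\gamma)$, the minimizer over $\eta\in(0,\infty)$ of $$\frac{\max[1,\nu_+(A(\ell,\eta))]}{\min[1,\nu_-(A(\ell,\eta))]}$$ is $\eta=\eta_1^*(\lambda)$, where $$\eta_1^*(\lambda)=\begin{cases}\dfrac{\ell}{1+\gamma+\frac{2\gamma}{\ell-1}},&\ell>\ell_1^+(\gamma),\\[2mm]1,&\ell\le\ell_1^+(\gamma).\end{cases}$$
   Context: Fix $\gamma>0$. $\ell_+(\gamma)=1+\sqrt\gamma$. For $\ell>\ell_+(\gamma)$, $\lambda(\ell;\gamma)=\ell(1+\frac{\gamma}{\ell-1})$, which is a bijection of $(\ell_+(\gamma),\infty)$ onto $((1+\sqrt\gamma)^2,\infty)$; thus expressions may be written in $\ell$ or $\lambda$ interchangeably. $c=c(\ell;\gamma)=\sqrt{\frac{1-\gamma/(\ell-1)^2}{1+\gamma/(\ell-1)}}$ for $\ell>\ell_+(\gamma)$ and $s=\sqrt{1-c^2}$. $$A(\ell,\eta)=\begin{bmatrix}\frac{\eta c^2+s^2}{\ell}&\frac{(\eta-1)cs}{\sqrt\ell}\\ \frac{(\eta-1)cs}{\sqrt\ell}&c^2+\eta s^2\end{bmatrix},$$ and $\nu_-(A)\le\nu_+(A)$ denote the two eigenvalues of the symmetric matrix $A$. The displayed ratio is the condition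 number of $A(\ell,\eta)\oplus I_{p-2}$ for $p>2$. *)

theory Defs
  imports Complex_Main "Jordan_Normal_Form.Spectral_Radius"
begin

definition ell_plus :: "real \<Rightarrow> real" where
  "ell_plus \<gamma> = 1 + sqrt \<gamma>"

definition ell1_plus :: "real \<Rightarrow> real" where
  "ell1_plus \<gamma> = 1 + (\<gamma> + sqrt (\<gamma>\<^sup>2 + 8 * \<gamma>)) / 2"

definition lam :: "real \<Rightarrow> real \<Rightarrow> real" where
  "lam \<gamma> l = l * (1 + \<gamma> / (l - 1))"

lemma bij_betw_lam:
  assumes "\<gamma> > 0"
  shows "bij_betw (lam \<gamma>) {ell_plus \<gamma><..} {(1 + sqrt \<gamma>)\<^sup>2<..}"
proof -
  define r where "r = sqrt \<gamma>"
  have r: "r > 0" "\<gamma> = r\<^sup>2"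
    using assms by (auto simp: r_def)
  have lam_shift: "lam \<gamma> (1 + x) = x + 1 + \<gamma> + \<gamma> / x" if "x > 0" for x
    using that by (simp add: lam_def field_simps)
  have diff: "lam \<gamma> (1 + y) - lam \<gamma> (1 + x) = (y - x) * (x * y - \<gamma>) / (x * y)"
    if "x > 0" "y > 0" for x y
    using that by (simp add: lam_shift field_simps)
  have less: "lam \<gamma> (1 + x) < lam \<gamma> (1 + y)" if "r \<le> x" "x < y" for x y
  proof -
    have "r * r < x * y"
      using that r by (intro mult_le_less_imp_less) auto
    then have "(y - x) * (x * y - \<gamma>) / (x * y) > 0"
      using that r by (intro divide_pos_pos mult_pos_pos) (auto simp: power2_eq_square)
    then show ?thesis
      using diff[of x y] that r by linarith
  qed
  have at_r: "lam \<gamma> (1 + r) = (1 + r)\<^sup>2"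
    using r(1) by (subst lam_shift) (simp_all add: r(2) power2_eq_square algebra_simps)
  have mono: "strict_mono_on {ell_plus \<gamma><..} (lam \<gamma>)"
  proof (rule strict_mono_onI)
    fix u v assume "u \<in> {ell_plus \<gamma><..}" "v \<in> {ell_plus \<gamma><..}" "u < v"
    then show "lam \<gamma> u < lam \<gamma> v"
      using less[of "u - 1" "v - 1"] by (simp add: ell_plus_def r_def)
  qed
  have "lam \<gamma> ` {ell_plus \<gamma><..} = {(1 + r)\<^sup>2<..}"
  proof (intro equalityI subsetI)
    fix z assume "z \<in> lam \<gamma> ` {ell_plus \<gamma><..}"
    then obtain u where "u > 1 + r" "z = lam \<gamma> u"
      by (auto simp: ell_plus_def r_def)
    then show "z \<in> {(1 + r)\<^sup>2<..}"
      using less[of r "u - 1"] at_r by simp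
  next
    fix z assume z: "z \<in> {(1 + r)\<^sup>2<..}"
    have "(1 + r)\<^sup>2 \<ge> 1 + r"
      using r by (simp add: power2_eq_square algebra_simps)
    with z have zr: "z > 1 + r" by simp
    have pos: "z - 1 > 0" using zr r by simp
    have "z \<le> lam \<gamma> (1 + (z - 1))"
      using pos assms by (subst lam_shift) auto
    moreover have "isCont (lam \<gamma>) x" if "1 + r \<le> x" for x
      unfolding lam_def using that r by (intro continuous_intros) auto
    ultimately obtain x where x: "1 + r \<le> x" "lam \<gamma> x = z"
      using IVT[of "lam \<gamma>" "1 + r" z z] at_r z zr by auto
    have "x \<noteq> 1 + r"
      using x z at_r by auto
    with x show "z \<in> lam \<gamma> ` {ell_plus \<gamma><..}"
      by (intro image_eqI[of _ _ x]) (auto simp: ell_plus_def r_def)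
  qed
  with mono show ?thesis
    by (simp add: bij_betw_def strict_mono_on_imp_inj_on r_def)
qed

definition c_spike :: "real \<Rightarrow> real \<Rightarrow> real" where
  "c_spike \<gamma> l = sqrt ((1 - \<gamma> / (l - 1)\<^sup>2) / (1 + \<gamma> / (l - 1)))"

definition s_spike :: "real \<Rightarrow> real \<Rightarrow> real" where
  "s_spike \<gamma> l = sqrt (1 - (c_spike \<gamma> l)\<^sup>2)"

definition A_mat :: "real \<Rightarrow> real \<Rightarrow> real \<Rightarrow> real mat" where
  "A_mat \<gamma> l \<eta> = mat_of_rows_list 2
     [[(\<eta> * (c_spike \<gamma> l)\<^sup>2 + (s_spike \<gamma> l)\<^sup>2) / l, (\<eta> - 1) * c_spike \<gamma> l * s_spike \<gamma> l / sqrt l],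
      [(\<eta> - 1) * c_spike \<gamma> l * s_spike \<gamma> l / sqrt l, (c_spike \<gamma> l)\<^sup>2 + \<eta> * (s_spike \<gamma> l)\<^sup>2]]"

(* The smaller and the larger of the two eigenvalues of a symmetric 2 x 2 matrix;
   they coincide when there is a repeated eigenvalue. *)
definition nu_minus :: "real mat \<Rightarrow> real" where
  "nu_minus M = Min (spectrum M)"

definition nu_plus :: "real mat \<Rightarrow> real" where
  "nu_plus M = Max (spectrum M)"

definition cond_ratio :: "real \<Rightarrow> real \<Rightarrow> real \<Rightarrow> real" where
  "cond_ratio \<gamma> l \<eta> = max 1 (nu_plus (A_mat \<gamma> l \<eta>)) / min 1 (nu_minus (A_mat \<gamma> l \<eta>))"

(* The shrinker is a function of z = lam \<gamma> l; inverting the bijection lam \<gamma> recovers l. *)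
definition eta1_star :: "real \<Rightarrow> real \<Rightarrow> real" where
  "eta1_star \<gamma> z =
     (let l = inv_into {ell_plus \<gamma><..} (lam \<gamma>) z
      in if l > ell1_plus \<gamma> then l / (1 + \<gamma> + 2 * \<gamma> / (l - 1)) else 1)"

lemma eta1_star_lam:
  assumes "\<gamma> > 0" "l > ell_plus \<gamma>"
  shows "eta1_star \<gamma> (lam \<gamma> l) =
    (if l > ell1_plus \<gamma> then l / (1 + \<gamma> + 2 * \<gamma> / (l - 1)) else 1)"
  using bij_betw_inv_into_left[OF bij_betw_lam[OF assms(1)], of l] assms(2)
  by (simp add: eta1_star_def)

end

(* det A = eta/l and tr A = a eta + b, while the characteristic polynomial of A has the sign of
   1 - eta at 1 and the sign of eta - 1 at 1/l.  For eta >= 1 the number 1 lies between the two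
   eigenvalues, so the ratio R is nu_+/nu_- and R + 1/R + 2 = (tr A)^2 / det A = l (a eta + b)^2 / eta,
   which is minimal on [1, oo) only at max 1 (b/a).  For eta < 1 we get nu_- < 1/l, hence R > l,
   the value of R at eta = 1. *)

theory Submission
  imports Defs
begin

section \<open>Determinant and spectrum of 2 x 2 matrices\<close>

lemma det_2x2:
  fixes A :: "'a :: comm_ring_1 mat"
  assumes A: "A \<in> carrier_mat 2 2"
  shows "det A = A $$ (0,0) * A $$ (1,1) - A $$ (0,1) * A $$ (1,0)"
proof -
  have "det A = (\<Sum>i<2. A $$ (i, 0) * cofactor A i 0)"
    by (rule laplace_expansion_column[OF A]) simp
  then show ?thesis
    using carrier_matD[OF A]
    by (simp add: cofactor_def mat_delete_def det_single numeral_2_eq_2 mult.commute)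
qed

lemma char_poly_2x2:
  fixes A :: "'a :: comm_ring_1 mat"
  assumes A: "A \<in> carrier_mat 2 2"
  shows "char_poly A =
    [:- A $$ (0,0), 1:] * [:- A $$ (1,1), 1:] - [:- A $$ (0,1):] * [:- A $$ (1,0):]"
proof -
  have "char_poly_matrix A \<in> carrier_mat 2 2"
    using A by simp
  then show ?thesis
    unfolding char_poly_def using carrier_matD[OF A]
    by (simp add: det_2x2 char_poly_matrix_def)
qed

text \<open>Symmetry makes the discriminant a sum of squares, so both roots are real; for
  \<open>D = 0\<close> the set collapses to one point.\<close>

lemma spectrum_symmetric_2x2:
  fixes p q r :: real
  defines "D \<equiv> sqrt ((p - r)\<^sup>2 + 4 * q\<^sup>2)"
  shows "spectrum (mat_of_rows_list 2 [[p, q], [q, r]]) = {(p + r - D) / 2, (p + r + D) / 2}"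
proof -
  let ?A = "mat_of_rows_list 2 [[p, q], [q, r]]"
  have A: "?A \<in> carrier_mat 2 2"
    by (rule carrier_matI) (simp_all add: mat_of_rows_list_def)
  have entries: "?A $$ (0,0) = p" "?A $$ (0,1) = q" "?A $$ (1,0) = q" "?A $$ (1,1) = r"
    unfolding mat_of_rows_list_def by simp_all
  have D: "D\<^sup>2 = (p - r)\<^sup>2 + 4 * q\<^sup>2"
    unfolding D_def by simp
  have "eigenvalue ?A k \<longleftrightarrow> k = (p + r - D) / 2 \<or> k = (p + r + D) / 2" for k
  proof -
    have "poly (char_poly ?A) k = (k - p) * (k - r) - q\<^sup>2"
      unfolding char_poly_2x2[OF A] entries by (simp add: power2_eq_square algebra_simps)
    also have "\<dots> = (k - (p + r) / 2)\<^sup>2 - D\<^sup>2 / 4"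
      unfolding D by (simp add: power2_eq_square field_simps)
    also have "\<dots> = (k - (p + r - D) / 2) * (k - (p + r + D) / 2)"
      by (simp add: power2_eq_square field_simps)
    finally show ?thesis
      unfolding eigenvalue_root_char_poly[OF A] by simp
  qed
  then show ?thesis
    unfolding spectrum_def by blast
qed

text \<open>Vieta's formulas. The later argument uses only order, sum and product of the
  eigenvalues, so the root \<open>D\<close> disappears here.\<close>

lemma nu_symmetric_2x2:
  fixes p q r :: real
  defines "M \<equiv> mat_of_rows_list 2 [[p, q], [q, r]]"
  shows nu_minus_le_nu_plus: "nu_minus M \<le> nu_plus M"
    and nu_sum: "nu_minus M + nu_plus M = p + r"
    and nu_prod: "nu_minus M * nu_plus M = p * r - q\<^sup>2"
proof -
  define D where "D = sqrt ((p - r)\<^sup>2 + 4 * q\<^sup>2)"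
  have D: "D \<ge> 0" "D\<^sup>2 = (p - r)\<^sup>2 + 4 * q\<^sup>2"
    unfolding D_def by simp_all
  have nu: "nu_minus M = (p + r - D) / 2" "nu_plus M = (p + r + D) / 2"
    using D(1) unfolding nu_minus_def nu_plus_def M_def spectrum_symmetric_2x2 D_def[symmetric]
    by (simp_all add: min_def max_def)
  show "nu_minus M \<le> nu_plus M" "nu_minus M + nu_plus M = p + r"
    "nu_minus M * nu_plus M = p * r - q\<^sup>2"
    using D unfolding nu by (simp_all add: power2_eq_square field_simps)
qed

section \<open>Two inequalities for real functions\<close>

lemma add_inverse_mono:
  fixes u v :: real
  assumes "1 \<le> u" "u \<le> v"
  shows "u + 1 / u \<le> v + 1 / v"
proof -
  have "1 \<le> u * v"
    using mult_mono[of 1 u 1 v] assms by simp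
  then have "0 \<le> (v - u) * (u * v - 1) / (u * v)"
    using assms by simp
  also have "\<dots> = v + 1 / v - (u + 1 / u)"
    using assms by (simp add: field_simps)
  finally show ?thesis
    by simp
qed

text \<open>Right side minus left side is
  \<open>(u - t) * (a\<^sup>2 * (u * t) - b\<^sup>2) / (u * t)\<close>. If \<open>b \<le> a\<close>,
  then \<open>t = 1\<close> and both factors of the numerator are positive; otherwise
  \<open>t = b / a\<close> and the numerator is \<open>a * b * (u - t)\<^sup>2\<close>.\<close>

lemma linear_square_over_less:
  fixes a b t u :: real
  assumes pos: "a > 0" "b > 0" "u \<ge> 1" and t: "t = max 1 (b / a)" and ne: "u \<noteq> t"
  shows "(a * t + b)\<^sup>2 / t < (a * u + b)\<^sup>2 / u"
proof -
  have "t \<ge> 1"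
    using t by simp
  have "0 < (u - t) * (a\<^sup>2 * (u * t) - b\<^sup>2)"
  proof (cases "b \<le> a")
    case True
    then have [simp]: "t = 1"
      using t pos by (simp add: max_def)
    have "u > 1"
      using pos ne by simp
    have "b\<^sup>2 \<le> a\<^sup>2"
      using True pos by (simp add: power_mono)
    moreover have "a\<^sup>2 < a\<^sup>2 * u"
      using pos \<open>u > 1\<close> by simp
    ultimately show ?thesis
      using \<open>u > 1\<close> by simp
  next
    case False
    then have "a * t = b"
      using t pos by (simp add: max_def)
    then have "(u - t) * (a\<^sup>2 * (u * t) - b\<^sup>2) = a * b * (u - t)\<^sup>2"
      by (auto simp: power2_eq_square algebra_simps)
    then show ?thesis
      using pos ne by simp
  qed
  then have "0 < (u - t) * (a\<^sup>2 * (u * t) - b\<^sup>2) / (u * t)"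
    using pos \<open>t \<ge> 1\<close> by simp
  also have "\<dots> = (a * u + b)\<^sup>2 / u - (a * t + b)\<^sup>2 / t"
    using pos \<open>t \<ge> 1\<close> by (simp add: power2_eq_square field_simps)
  finally show ?thesis
    by simp
qed

section \<open>The squares of c and s as rational functions\<close>

context
  fixes \<gamma> l :: real
  assumes \<gamma>: "\<gamma> > 0" and l: "l > ell_plus \<gamma>"
begin

lemma l_gt_1: "l > 1" and l_square: "\<gamma> < (l - 1)\<^sup>2"
proof -
  have "sqrt \<gamma> < l - 1" "sqrt \<gamma> > 0"
    using l \<gamma> by (simp_all add: ell_plus_def)
  then show "l > 1"
    by linarith
  show "\<gamma> < (l - 1)\<^sup>2"
    using power_strict_mono[of "sqrt \<gamma>" "l - 1" 2] \<open>sqrt \<gamma> < l - 1\<close> \<gamma> by simp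
qed

lemma c_spike_sq: "(c_spike \<gamma> l)\<^sup>2 = ((l - 1)\<^sup>2 - \<gamma>) / ((l - 1) * (l - 1 + \<gamma>))"
proof -
  define x where "x = l - 1"
  have x: "x > 0" "x + \<gamma> > 0" "\<gamma> < x\<^sup>2"
    using l_gt_1 l_square \<gamma> by (auto simp: x_def)
  \<comment> \<open>The radicand of \<open>c_spike\<close> is nonnegative, so squaring cancels the
    root.\<close>
  have "\<gamma> / x\<^sup>2 \<le> 1"
    using x by simp
  then have "(c_spike \<gamma> l)\<^sup>2 = (1 - \<gamma> / x\<^sup>2) / (1 + \<gamma> / x)"
    using \<gamma> x by (simp add: c_spike_def x_def[symmetric])
  also have "1 - \<gamma> / x\<^sup>2 = (x\<^sup>2 - \<gamma>) / x\<^sup>2"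
    using x by (simp add: diff_divide_distrib)
  also have "1 + \<gamma> / x = x * (x + \<gamma>) / x\<^sup>2"
    using x by (simp add: add_divide_distrib power2_eq_square)
  finally show ?thesis
    using x by (simp add: x_def)
qed

lemma c_spike_sq_pos: "(c_spike \<gamma> l)\<^sup>2 > 0"
  unfolding c_spike_sq using l_gt_1 l_square \<gamma> by simp

lemma c_s_spike_sq: "(c_spike \<gamma> l)\<^sup>2 + (s_spike \<gamma> l)\<^sup>2 = 1"
  and s_spike_sq: "(s_spike \<gamma> l)\<^sup>2 = \<gamma> * l / ((l - 1) * (l - 1 + \<gamma>))"
proof -
  define k where "k = (l - 1) * (l - 1 + \<gamma>)"
  have k: "k > 0"
    using l_gt_1 \<gamma> by (simp add: k_def)
  have "1 - (c_spike \<gamma> l)\<^sup>2 = (k - ((l - 1)\<^sup>2 - \<gamma>)) / k"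
    unfolding c_spike_sq k_def[symmetric] using k by (simp add: diff_divide_distrib)
  also have "k - ((l - 1)\<^sup>2 - \<gamma>) = \<gamma> * l"
    by (simp add: k_def power2_eq_square algebra_simps)
  finally have eq: "1 - (c_spike \<gamma> l)\<^sup>2 = \<gamma> * l / k" .
  \<comment> \<open>This says that c^2 is at most 1, which lets squaring cancel the root in
    \<open>s_spike\<close>.\<close>
  have "\<gamma> * l / k \<ge> 0"
    using k l_gt_1 \<gamma> by simp
  then have "(s_spike \<gamma> l)\<^sup>2 = \<gamma> * l / k"
    by (simp add: s_spike_def eq)
  with eq show "(c_spike \<gamma> l)\<^sup>2 + (s_spike \<gamma> l)\<^sup>2 = 1"
    "(s_spike \<gamma> l)\<^sup>2 = \<gamma> * l / ((l - 1) * (l - 1 + \<gamma>))"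
    by (simp_all add: k_def)
qed

section \<open>Trace, determinant and eigenvalues of A as functions of eta\<close>

definition tr_slope :: real where
  "tr_slope = ((c_spike \<gamma> l)\<^sup>2 + l * (s_spike \<gamma> l)\<^sup>2) / l"

text \<open>The trace of A is affine in eta: this is its constant term b, and
  \<open>tr_slope\<close> is the coefficient a.\<close>

definition tr_offset :: real where
  "tr_offset = ((s_spike \<gamma> l)\<^sup>2 + l * (c_spike \<gamma> l)\<^sup>2) / l"

lemma tr_slope_pos: "tr_slope > 0" and tr_offset_pos: "tr_offset > 0"
proof -
  have "l > 0" "l * (s_spike \<gamma> l)\<^sup>2 \<ge> 0" "l * (c_spike \<gamma> l)\<^sup>2 > 0"
    using l_gt_1 c_spike_sq_pos by simp_all
  then show "tr_slope > 0" "tr_offset > 0"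
    unfolding tr_slope_def tr_offset_def using c_spike_sq_pos
    by (simp_all only: divide_pos_pos add_pos_nonneg add_nonneg_pos zero_le_power2)
qed

text \<open>With the unit vector v = (c, s) and L = diag(1 / sqrt l, 1), the matrix is L (I + (eta -
  1) v v^T) L, whence the determinant eta / l.\<close>

lemma A_mat_nu:
  defines "m \<equiv> \<lambda>\<eta>. nu_minus (A_mat \<gamma> l \<eta>)" and "n \<equiv> \<lambda>\<eta>. nu_plus (A_mat \<gamma> l \<eta>)"
  shows "m \<eta> \<le> n \<eta>"
    and "m \<eta> + n \<eta> = tr_slope * \<eta> + tr_offset"
    and "m \<eta> * n \<eta> = \<eta> / l"
proof -
  let ?c = "c_spike \<gamma> l" and ?s = "s_spike \<gamma> l"
  show "m \<eta> \<le> n \<eta>"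
    unfolding m_def n_def A_mat_def by (rule nu_minus_le_nu_plus)
  show "m \<eta> + n \<eta> = tr_slope * \<eta> + tr_offset"
    unfolding m_def n_def A_mat_def nu_sum tr_slope_def tr_offset_def
    using l_gt_1 by (simp add: field_simps)
  have "m \<eta> * n \<eta> = (\<eta> * ?c\<^sup>2 + ?s\<^sup>2) / l * (?c\<^sup>2 + \<eta> * ?s\<^sup>2) - (\<eta> - 1)\<^sup>2 * ?c\<^sup>2 * ?s\<^sup>2 / l"
    unfolding m_def n_def A_mat_def nu_prod
    using l_gt_1 by (simp add: power_mult_distrib power_divide)
  \<comment> \<open>The mixed terms combine through eta^2 + 1 - (eta - 1)^2 = 2 eta.\<close>
  also have "\<dots> = \<eta> * (?c\<^sup>2 + ?s\<^sup>2)\<^sup>2 / l"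
    using l_gt_1 by (simp add: field_simps) (simp add: power2_eq_square power4_eq_xxxx algebra_simps)
  finally show "m \<eta> * n \<eta> = \<eta> / l"
    by (simp add: c_s_spike_sq)
qed

lemma A_mat_nu_pos:
  assumes "\<eta> > 0"
  shows "nu_minus (A_mat \<gamma> l \<eta>) > 0" "nu_plus (A_mat \<gamma> l \<eta>) > 0"
proof -
  let ?m = "nu_minus (A_mat \<gamma> l \<eta>)" and ?n = "nu_plus (A_mat \<gamma> l \<eta>)"
  have "?m * ?n > 0"
    using A_mat_nu(3)[of \<eta>] assms l_gt_1 by simp
  moreover have "?m + ?n > 0"
    unfolding A_mat_nu(2) using assms tr_slope_pos tr_offset_pos by (simp add: add_pos_pos)
  ultimately show "?m > 0" "?n > 0"
    by (auto simp: zero_less_mult_iff)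
qed

text \<open>Trace and determinant are affine in eta, hence so is this value. At eta = 1 the matrix
  is diag(1 / l, 1), which forces the factor \<open>1 - \<eta>\<close>.\<close>

lemma char_poly_at_1:
  "(1 - nu_minus (A_mat \<gamma> l \<eta>)) * (1 - nu_plus (A_mat \<gamma> l \<eta>))
     = (l - 1) * (s_spike \<gamma> l)\<^sup>2 / l * (1 - \<eta>)"
proof -
  have c: "(c_spike \<gamma> l)\<^sup>2 = 1 - (s_spike \<gamma> l)\<^sup>2"
    using c_s_spike_sq by simp
  let ?m = "nu_minus (A_mat \<gamma> l \<eta>)" and ?n = "nu_plus (A_mat \<gamma> l \<eta>)"
  have "(1 - ?m) * (1 - ?n) = 1 - (?m + ?n) + ?m * ?n"
    by (simp add: algebra_simps)
  also have "\<dots> = (l - 1) * (s_spike \<gamma> l)\<^sup>2 / l * (1 - \<eta>)"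
    unfolding A_mat_nu tr_slope_def tr_offset_def c using l_gt_1 by (simp add: field_simps)
  finally show ?thesis .
qed

text \<open>The same reasoning at the other diagonal entry 1 / l. Here the coefficient is strictly
  positive because c^2 is, which later gives a strict bound for eta < 1.\<close>

lemma char_poly_at_inverse:
  "(1 / l - nu_minus (A_mat \<gamma> l \<eta>)) * (1 / l - nu_plus (A_mat \<gamma> l \<eta>))
     = (l - 1) * (c_spike \<gamma> l)\<^sup>2 / l\<^sup>2 * (\<eta> - 1)"
proof -
  have s: "(s_spike \<gamma> l)\<^sup>2 = 1 - (c_spike \<gamma> l)\<^sup>2"
    using c_s_spike_sq by simp
  let ?m = "nu_minus (A_mat \<gamma> l \<eta>)" and ?n = "nu_plus (A_mat \<gamma> l \<eta>)"
  have "(1 / l - ?m) * (1 / l - ?n) = 1 / l\<^sup>2 - (?m + ?n) / l + ?m * ?n"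
    by (simp add: algebra_simps power2_eq_square add_divide_distrib)
  also have "\<dots> = (l - 1) * (c_spike \<gamma> l)\<^sup>2 / l\<^sup>2 * (\<eta> - 1)"
    unfolding A_mat_nu tr_slope_def tr_offset_def s
    using l_gt_1 by (simp add: field_simps power2_eq_square)
  finally show ?thesis .
qed

section \<open>The ratio for eta above, at and below 1\<close>

lemma cond_ratio_ge_1:
  assumes "\<eta> \<ge> 1"
  shows "cond_ratio \<gamma> l \<eta> \<ge> 1"
    and "cond_ratio \<gamma> l \<eta> + 1 / cond_ratio \<gamma> l \<eta> + 2 = l * ((tr_slope * \<eta> + tr_offset)\<^sup>2 / \<eta>)"
proof -
  define m n where "m = nu_minus (A_mat \<gamma> l \<eta>)" and "n = nu_plus (A_mat \<gamma> l \<eta>)"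
  have pos: "m > 0" "n > 0"
    using A_mat_nu_pos[of \<eta>] assms by (simp_all add: m_def n_def)
  have mn: "m \<le> n"
    unfolding m_def n_def by (rule A_mat_nu(1))
  have "(1 - m) * (1 - n) \<le> 0"
    unfolding m_def n_def char_poly_at_1
    using l_gt_1 assms by (intro mult_nonneg_nonpos) auto
  \<comment> \<open>Since 1 lies between the eigenvalues, the maximum and minimum with 1 in the
    ratio have no effect.\<close>
  with mn have "m \<le> 1" "1 \<le> n"
    by (auto simp: mult_le_0_iff)
  then have R: "cond_ratio \<gamma> l \<eta> = n / m"
    by (simp add: cond_ratio_def m_def n_def max_def min_def)
  show "cond_ratio \<gamma> l \<eta> \<ge> 1"
    unfolding R using mn pos by simp
  \<comment> \<open>Adding the reciprocal makes the expression symmetric in \<open>m\<close> and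
    \<open>n\<close>, hence a function of trace and determinant.\<close>
  have "n / m + 1 / (n / m) + 2 = (m + n)\<^sup>2 / (m * n)"
    using pos by (simp add: power2_eq_square field_simps)
  also have "\<dots> = l * ((tr_slope * \<eta> + tr_offset)\<^sup>2 / \<eta>)"
    unfolding m_def n_def A_mat_nu by simp
  finally show "cond_ratio \<gamma> l \<eta> + 1 / cond_ratio \<gamma> l \<eta> + 2 = l * ((tr_slope * \<eta> + tr_offset)\<^sup>2 / \<eta>)"
    unfolding R .
qed

text \<open>One eigenvalue is 1, the determinant makes the other 1 / l, and \<open>1 / l < 1\<close>
  decides which is the smaller.\<close>

lemma cond_ratio_at_1: "cond_ratio \<gamma> l 1 = l"
proof -
  let ?m = "nu_minus (A_mat \<gamma> l 1)" and ?n = "nu_plus (A_mat \<gamma> l 1)"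
  have mn: "?m \<le> ?n" "?m * ?n = 1 / l"
    by (rule A_mat_nu)+
  have "1 / l < 1"
    using l_gt_1 by simp
  have "?m = 1 \<or> ?n = 1"
    using char_poly_at_1[of 1] by simp
  then have "?n = 1" "?m = 1 / l"
    using mn \<open>1 / l < 1\<close> by auto
  then show ?thesis
    using l_gt_1 by (simp add: cond_ratio_def)
qed

text \<open>The sign at 1 / l forces \<open>m < 1 / l\<close>. As the numerator of the ratio is at
  least 1, the ratio is at least \<open>1 / m\<close>, which exceeds \<open>l\<close>.\<close>

lemma cond_ratio_lt_1:
  assumes "0 < \<eta>" "\<eta> < 1"
  shows "l < cond_ratio \<gamma> l \<eta>"
proof -
  define m n where "m = nu_minus (A_mat \<gamma> l \<eta>)" and "n = nu_plus (A_mat \<gamma> l \<eta>)"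
  have "m > 0" "m \<le> n"
    using A_mat_nu_pos[of \<eta>] A_mat_nu(1)[of \<eta>] assms by (simp_all add: m_def n_def)
  have "(1 / l - m) * (1 / l - n) < 0"
    unfolding m_def n_def char_poly_at_inverse
    using l_gt_1 assms c_spike_sq_pos by (intro mult_pos_neg) auto
  with \<open>m \<le> n\<close> have "m < 1 / l"
    by (auto simp: mult_less_0_iff)
  then have "l < 1 / m"
    using l_gt_1 \<open>m > 0\<close> by (simp add: field_simps)
  then have "m < 1"
    using l_gt_1 \<open>m > 0\<close> less_trans[of 1 l "1 / m"] by simp
  then have "cond_ratio \<gamma> l \<eta> = max 1 n / m"
    by (simp add: cond_ratio_def m_def n_def)
  also have "\<dots> \<ge> 1 / m"
    using \<open>m > 0\<close> by (intro divide_right_mono) auto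
  finally show ?thesis
    using \<open>l < 1 / m\<close> by linarith
qed

lemma cond_ratio_minimal:
  assumes t: "t = max 1 (tr_offset / tr_slope)" and "\<eta> > 0" "\<eta> \<noteq> t"
  shows "cond_ratio \<gamma> l t < cond_ratio \<gamma> l \<eta>"
proof -
  have less: "cond_ratio \<gamma> l t < cond_ratio \<gamma> l u" if "u \<ge> 1" "u \<noteq> t" for u
  proof (rule ccontr)
    assume "\<not> ?thesis"
    \<comment> \<open>The map x + 1 / x is monotone on [1, oo), so comparing ratios reduces to
      comparing the quotients of squared trace by determinant.\<close>
    then have "cond_ratio \<gamma> l u + 1 / cond_ratio \<gamma> l u \<le> cond_ratio \<gamma> l t + 1 / cond_ratio \<gamma> l t"
      using cond_ratio_ge_1(1)[OF that(1)] by (intro add_inverse_mono) auto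
    then have "l * ((tr_slope * u + tr_offset)\<^sup>2 / u) \<le> l * ((tr_slope * t + tr_offset)\<^sup>2 / t)"
      using cond_ratio_ge_1(2)[of u] cond_ratio_ge_1(2)[of t] that t by simp
    then have "(tr_slope * u + tr_offset)\<^sup>2 / u \<le> (tr_slope * t + tr_offset)\<^sup>2 / t"
      using l_gt_1 by (simp only: mult_le_cancel_left_pos)
    with linear_square_over_less[OF tr_slope_pos tr_offset_pos that(1) t that(2)] show False
      by simp
  qed
  show ?thesis
  proof (cases "\<eta> < 1")
    case True
    \<comment> \<open>The point 1 belongs to the branch already treated and links the two branches:
      R(t) \<le> R(1) = l < R(eta).\<close>
    have "cond_ratio \<gamma> l t \<le> cond_ratio \<gamma> l 1"
      using less[of 1] by (cases "t = 1") auto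
    with cond_ratio_lt_1[OF assms(2) True] cond_ratio_at_1 show ?thesis
      by linarith
  next
    case False
    with less assms show ?thesis by simp
  qed
qed

section \<open>Closed form of the minimizer and its threshold\<close>

lemma tr_offset_over_slope: "tr_offset / tr_slope = l / (1 + \<gamma> + 2 * \<gamma> / (l - 1))"
proof -
  define x k where "x = l - 1" and "k = x * (x + \<gamma>)"
  have x: "x > 0" "l = x + 1" and k: "k > 0"
    using l_gt_1 \<gamma> by (simp_all add: x_def k_def)
  have cs: "(c_spike \<gamma> l)\<^sup>2 = (x\<^sup>2 - \<gamma>) / k" "(s_spike \<gamma> l)\<^sup>2 = \<gamma> * l / k"
    by (simp_all add: c_spike_sq s_spike_sq x_def k_def)
  have "tr_offset = (\<gamma> * l + l * (x\<^sup>2 - \<gamma>)) / k / l"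
    unfolding tr_offset_def cs by (simp add: add_divide_distrib)
  also have "\<gamma> * l + l * (x\<^sup>2 - \<gamma>) = l * x\<^sup>2"
    by (simp add: algebra_simps)
  finally have offset: "tr_offset = l * x\<^sup>2 / k / l" .
  have "tr_slope = (x\<^sup>2 - \<gamma> + l * (\<gamma> * l)) / k / l"
    unfolding tr_slope_def cs by (simp add: add_divide_distrib)
  \<comment> \<open>With \<open>l = x + 1\<close> one has l^2 - 1 = x^2 + 2 x, so the left side is
    x^2 + \<gamma> (x^2 + 2 x).\<close>
  also have "x\<^sup>2 - \<gamma> + l * (\<gamma> * l) = x\<^sup>2 * (1 + \<gamma> + 2 * \<gamma> / x)"
    using x by (simp add: field_simps power2_eq_square)
  finally show ?thesis
    unfolding offset using k l_gt_1 x(1) by (simp add: x_def[symmetric])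
qed

text \<open>Clearing denominators with \<open>x = l - 1\<close> leaves the quadratic inequality
  \<open>0 < x\<^sup>2 - \<gamma> * x - 2 * \<gamma>\<close>, whose positive root is
  \<open>ell1_plus \<gamma> - 1\<close>.\<close>

lemma ell1_plus_less_iff: "ell1_plus \<gamma> < l \<longleftrightarrow> 1 < l / (1 + \<gamma> + 2 * \<gamma> / (l - 1))"
proof -
  define x d where "x = l - 1" and "d = sqrt (\<gamma>\<^sup>2 + 8 * \<gamma>)"
  have x: "x > 0" "l = x + 1"
    using l_gt_1 by (simp_all add: x_def)
  have d: "d\<^sup>2 = \<gamma>\<^sup>2 + 8 * \<gamma>"
    using \<gamma> by (simp add: d_def)
  have "\<gamma> < d"
    unfolding d_def using \<gamma> by (intro real_less_rsqrt) simp
  have "1 < l / (1 + \<gamma> + 2 * \<gamma> / x) \<longleftrightarrow> 1 + \<gamma> + 2 * \<gamma> / x < l"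
    using x \<gamma> by (subst less_divide_eq_1_pos) (auto intro!: add_pos_pos)
  also have "\<dots> \<longleftrightarrow> 0 < x\<^sup>2 - \<gamma> * x - 2 * \<gamma>"
    using x by (auto simp: field_simps power2_eq_square)
  also have "x\<^sup>2 - \<gamma> * x - 2 * \<gamma> = (x - (\<gamma> + d) / 2) * (x - (\<gamma> - d) / 2)"
    using d by (simp add: field_simps power2_eq_square)
  \<comment> \<open>The other root is negative by \<open>\<gamma> < d\<close>, so its factor is
    positive for \<open>x > 0\<close>.\<close>
  also have "0 < \<dots> \<longleftrightarrow> (\<gamma> + d) / 2 < x"
    using x \<open>\<gamma> < d\<close> by (subst zero_less_mult_iff) auto
  also have "\<dots> \<longleftrightarrow> ell1_plus \<gamma> < l"
    unfolding ell1_plus_def d_def x_def by (rule iffI) linarith+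
  finally show ?thesis
    by (simp add: x_def)
qed

text \<open>The two cases of the shrinker amount to truncating the critical point b / a at
  1.\<close>

lemma eta1_star_eq_max: "eta1_star \<gamma> (lam \<gamma> l) = max 1 (tr_offset / tr_slope)"
  using ell1_plus_less_iff by (auto simp: eta1_star_lam[OF \<gamma> l] tr_offset_over_slope max_def)

text \<open>Strict inequality against every other positive point gives both minimality and
  uniqueness.\<close>

lemma is_arg_min_cond_ratio_iff:
  "is_arg_min (cond_ratio \<gamma> l) (\<lambda>\<eta>. \<eta> > 0) \<eta> \<longleftrightarrow> \<eta> = eta1_star \<gamma> (lam \<gamma> l)"
proof -
  let ?t = "eta1_star \<gamma> (lam \<gamma> l)"
  have "?t > 0"
    unfolding eta1_star_eq_max by simp
  moreover have "cond_ratio \<gamma> l ?t < cond_ratio \<gamma> l u" if "u > 0" "u \<noteq> ?t" for u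
    using that by (intro cond_ratio_minimal eta1_star_eq_max)
  ultimately show ?thesis
    unfolding is_arg_min_def by (metis less_asym)
qed

end

theorem theorem3p1p1:
  fixes \<gamma> :: real
  assumes "\<gamma> > 0"
  shows "ell1_plus \<gamma> > ell_plus \<gamma> \<and>
    (\<forall>l>ell_plus \<gamma>. \<forall>\<eta>.
       is_arg_min (cond_ratio \<gamma> l) (\<lambda>\<eta>. \<eta> > 0) \<eta> \<longleftrightarrow> \<eta> = eta1_star \<gamma> (lam \<gamma> l))"
proof
  \<comment> \<open>After subtracting 1, half of
    \<open>sqrt (\<gamma>\<^sup>2 + 8 * \<gamma>)\<close> alone already exceeds
    \<open>sqrt \<gamma>\<close>.\<close>
  have "2 * sqrt \<gamma> = sqrt (4 * \<gamma>)"
    by (simp add: real_sqrt_mult)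
  also have "\<dots> < sqrt (\<gamma>\<^sup>2 + 8 * \<gamma>)"
    using assms by (simp add: add_pos_pos)
  finally show "ell1_plus \<gamma> > ell_plus \<gamma>"
    using assms by (simp add: ell1_plus_def ell_plus_def)
qed (simp add: is_arg_min_cond_ratio_iff[OF assms])

end
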